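(* Let $\theta_0,\ldots,\theta_{m-1}$ ($m\ge3$) be a unimodular partition of the unit circle $S^1$ with associated map $B:S^1\to S^1$ and groups $\varGamma_B^\pm$, $\varGamma_B$. The map $B$ and the group $\varGamma_B^\pm$ are orbit equivalent. More precisely, given $\sigma,\sigma'\in S^1$, there exists $\mathscr{A}\in\varGamma_B^\pm$ such that $\sigma'=\mathscr{A}*\sigma$ if and only if there exist $h,k\ge0$ such that $B^h(\sigma)=B^k(\sigma')$. In particular, if $\sigma$ belongs to $\mathbb{Q}(i)$ then it is $B$-terminating, its orbit landing in the unique vertex among $\theta_0,\ldots,\theta_{m-1}$ which is $\varGamma_B$-equivalent to $\sigma$.
   Context: $S^1=\{z\in\mathbb{C}:|z|=1\}$ is the boundary of the Poincar\'e disk $\mathcal{D}$. A pythagorean triple is $\mathbf{t}=(t_1,t_2,t_3)\in\mathbb{Z}^3$ with $t_3>0$, $\gcd(t_1,t_2,t_3)=1$, $t_1^2+t_2^2=t_3^2$; it is identified with the point $\theta=(t_1+t_2i)/t_3\in S^1\cap\mathbb{Q}(i)$. Let $L=\mathrm{diag}(1,1,-1)$ and $\langle \mathbf{x},\mathbf{y}\rangle=\mathbf{x}^\top L\mathbf{y}$. For distinct pythagorean triples $\mathbf{t},\mathbf{t}'$, the closed arc $[\mathbf{t},\mathbf{t}']$ going counterclockwise from $\mathbf{t}$ to $\mathbf{t}'$ is unimodular if $\mathbf{w}=(L\mathbf{t}'\times L\mathbf{t})/\langle\mathbf{t}',\mathbf{t}\rangle\in\mathbb{Z}^3$. A unimodular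 partition of $S^1$ is a counterclockwise cyclically ordered $m$-tuple $\mathbf{t}_0,\ldots,\mathbf{t}_{m-1}$ of pythagorean triples, $m\ge3$, such that each arc $[\mathbf{t}_a,\mathbf{t}_{a+1}]$ is unimodular (indices modulo $m$); $\theta_a\in S^1$ is the point identified with $\mathbf{t}_a$. Let $I_a=[\theta_a,\theta_{a+1})$ be the half-open counterclockwise arc, and let $\mathscr{A}_a$ be the hyperbolic reflection of $\mathcal{D}$ in the geodesic with ideal endpoints $\theta_a,\theta_{a+1}$, acting on $S^1$ by $\mathscr{A}_a*z=\frac{(\theta_a+\theta_{a+1})z-2\theta_a\theta_{a+1}}{2z-(\theta_a+\theta_{a+1})}$. The map $B:S^1\to S^1$ is $B(\sigma)=\mathscr{A}_a*\sigma$ for $\sigma\in I_a$. The group $\varGamma_B^\pm$ is the group of isometries of $\mathcal{D}$ generated by $\mathscr{A}_0,\ldots,\mathscr{A}_{m-1}$, acting also on $S^1$ (the action is denoted by $*$), and $\varGamma_B$ is its subgroup of orientation-preserving elements. A point $\sigma\in S^1$ is $B$-terminating if $B^h(\sigma)=\theta_a$ for some $h\ge0$ and some $a\in\{0,\ldots,m-1\}$. The points $\theta_0,\ldots,\theta_{m-1}$ are the vertices of the ideal polygon (billiard table) $D$ determined by the partition. *)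

theory Defs
  imports "HOL-Analysis.Analysis" "HOL-Algebra.Bij" "HOL-Algebra.Generated_Groups"
begin

section \<open>Pythagorean triples and unimodular arcs\<close>

definition pythagorean_triple :: "int ^ 3 \<Rightarrow> bool" where
  "pythagorean_triple t \<longleftrightarrow>
     t $ 3 > 0 \<and> Gcd {t $ 1, t $ 2, t $ 3} = 1 \<and> (t $ 1)\<^sup>2 + (t $ 2)\<^sup>2 = (t $ 3)\<^sup>2"

definition circle_point :: "int ^ 3 \<Rightarrow> complex" where
  "circle_point t = (of_int (t $ 1) + of_int (t $ 2) * \<i>) / of_int (t $ 3)"

definition real_vec :: "int ^ 3 \<Rightarrow> real ^ 3" where
  "real_vec t = (\<chi> i. of_int (t $ i))"

definition lorentz_matrix :: "real ^ 3 ^ 3" where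
  "lorentz_matrix = vector [vector [1, 0, 0], vector [0, 1, 0], vector [0, 0, -1]]"

definition lorentz :: "real ^ 3 \<Rightarrow> real ^ 3 \<Rightarrow> real" where
  "lorentz x y = x \<bullet> (lorentz_matrix *v y)"

definition arc_vector :: "int ^ 3 \<Rightarrow> int ^ 3 \<Rightarrow> real ^ 3" where
  "arc_vector t t' =
     (1 / lorentz (real_vec t') (real_vec t)) *\<^sub>R cross3 (lorentz_matrix *v real_vec t') (lorentz_matrix *v real_vec t)"

text \<open>Unimodularity of the counterclockwise arc from \<open>t\<close> to \<open>t'\<close>; it depends only on the
  ordered pair of endpoints.\<close>

definition unimodular_arc :: "int ^ 3 \<Rightarrow> int ^ 3 \<Rightarrow> bool" where
  "unimodular_arc t t' \<longleftrightarrow>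
     pythagorean_triple t \<and> pythagorean_triple t' \<and> t \<noteq> t' \<and> (\<forall>i. arc_vector t t' $ i \<in> \<int>)"

section \<open>Counterclockwise order on the circle and unimodular partitions\<close>

text \<open>For \<open>p\<close>, \<open>z\<close> on the unit circle, \<open>Arg2pi (z / p)\<close>, which lies in \<open>[0, 2\<pi>)\<close>, is the
  length of the counterclockwise path from \<open>p\<close> to \<open>z\<close>.\<close>

definition ccw_arc :: "complex \<Rightarrow> complex \<Rightarrow> complex set" where
  "ccw_arc p q = {z \<in> sphere 0 1. Arg2pi (z / p) < Arg2pi (q / p)}"

text \<open>An \<open>m\<close>-tuple is a function on \<open>nat\<close> read modulo \<open>m\<close>.\<close>

definition vertex :: "nat \<Rightarrow> (nat \<Rightarrow> int ^ 3) \<Rightarrow> nat \<Rightarrow> complex" where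
  "vertex m t a = circle_point (t (a mod m))"

text \<open>The points of the tuple are met in the given order, and are pairwise distinct, during one
  counterclockwise turn starting at the first of them.\<close>

definition ccw_cyclically_ordered :: "nat \<Rightarrow> (nat \<Rightarrow> int ^ 3) \<Rightarrow> bool" where
  "ccw_cyclically_ordered m t \<longleftrightarrow>
     strict_mono_on {..<m} (\<lambda>a. Arg2pi (vertex m t a / vertex m t 0))"

definition unimodular_partition :: "nat \<Rightarrow> (nat \<Rightarrow> int ^ 3) \<Rightarrow> bool" where
  "unimodular_partition m t \<longleftrightarrow>
     m \<ge> 3 \<and> (\<forall>a<m. pythagorean_triple (t a)) \<and> ccw_cyclically_ordered m t \<and>
     (\<forall>a<m. unimodular_arc (t a) (t (Suc a mod m)))"

section \<open>The billiard map\<close>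

definition circle_reflection :: "complex \<Rightarrow> complex \<Rightarrow> complex \<Rightarrow> complex" where
  "circle_reflection p q z = ((p + q) * z - 2 * p * q) / (2 * z - (p + q))"

text \<open>Only the values on the unit circle are meaningful: there the arcs are disjoint and cover,
  so the index exists and is unique.\<close>

definition billiard_map :: "nat \<Rightarrow> (nat \<Rightarrow> int ^ 3) \<Rightarrow> complex \<Rightarrow> complex" where
  "billiard_map m t \<sigma> =
     (let a = (THE a. a < m \<and> \<sigma> \<in> ccw_arc (vertex m t a) (vertex m t (Suc a)))
      in circle_reflection (vertex m t a) (vertex m t (Suc a)) \<sigma>)"

definition terminating :: "nat \<Rightarrow> (nat \<Rightarrow> int ^ 3) \<Rightarrow> complex \<Rightarrow> bool" where
  "terminating m t \<sigma> \<longleftrightarrow> (\<exists>h. \<exists>a<m. (billiard_map m t ^^ h) \<sigma> = vertex m t a)"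

section \<open>The groups\<close>

abbreviation disk :: "complex set" where
  "disk \<equiv> ball 0 1"

text \<open>The reflection of the Poincare disk in the geodesic with ideal endpoints \<open>p\<close>, \<open>q\<close>. If
  \<open>p + q \<noteq> 0\<close>, that geodesic lies on the circle with centre \<open>c = 2pq / (p + q)\<close> and squared radius
  \<open>\<bar>c\<bar>\<^sup>2 - 1\<close>, and this is the inversion in that circle; if \<open>p + q = 0\<close>, it is \<open>z \<mapsto> p\<^sup>2 cnj z\<close>,
  the Euclidean reflection in the diameter. On the unit circle \<open>cnj z = 1 / z\<close>, which turns the
  formula into \<^const>\<open>circle_reflection\<close>.\<close>

definition disk_reflection :: "complex \<Rightarrow> complex \<Rightarrow> complex \<Rightarrow> complex" where
  "disk_reflection p q z = ((p + q) - 2 * p * q * cnj z) / (2 - (p + q) * cnj z)"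

text \<open>The subgroup, generated by the reflections, of the group of all bijections of the disk.
  The elements of \<^const>\<open>BijGroup\<close> are extensional functions, hence the restriction.\<close>

definition billiard_group_pm :: "nat \<Rightarrow> (nat \<Rightarrow> int ^ 3) \<Rightarrow> (complex \<Rightarrow> complex) set" where
  "billiard_group_pm m t =
     generate (BijGroup disk)
       ((\<lambda>a. restrict (disk_reflection (vertex m t a) (vertex m t (Suc a))) disk) ` {..<m})"

text \<open>The determinant of the real-linear map \<open>g'\<close> on the complex plane, whose columns are
  \<open>g' 1\<close> and \<open>g' \<i>\<close>, is \<open>Re (g' 1) * Im (g' \<i>) - Im (g' 1) * Re (g' \<i>)\<close>.\<close>

definition orientation_preserving :: "(complex \<Rightarrow> complex) \<Rightarrow> bool" where
  "orientation_preserving g \<longleftrightarrow>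
     (\<forall>z\<in>disk. \<exists>g'. (g has_derivative g') (at z) \<and>
        Re (g' 1) * Im (g' \<i>) - Im (g' 1) * Re (g' \<i>) > 0)"

definition billiard_group :: "nat \<Rightarrow> (nat \<Rightarrow> int ^ 3) \<Rightarrow> (complex \<Rightarrow> complex) set" where
  "billiard_group m t = {g \<in> billiard_group_pm m t. orientation_preserving g}"

text \<open>Isometries of the disk act on the unit circle by continuous extension.\<close>

definition boundary_action :: "(complex \<Rightarrow> complex) \<Rightarrow> complex \<Rightarrow> complex" where
  "boundary_action g \<sigma> = Lim (at \<sigma> within disk) g"

definition gaussian_rationals :: "complex set" where
  "gaussian_rationals = {z. Re z \<in> \<rat> \<and> Im z \<in> \<rat>}"

end

theory Submission
  imports Defs
begin

text \<open>Orbit equivalence is formal. If \<open>\<sigma>\<close> lies in \<open>I\<^sub>a\<close> then the reflection \<open>A\<^sub>a\<close> acts on \<open>\<sigma>\<close> as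
  \<open>B\<close> does; otherwise \<open>A\<^sub>a\<close> either fixes \<open>\<sigma>\<close> or moves it into \<open>I\<^sub>a\<close>, from where \<open>B\<close> brings it back.
  So generators preserve eventual coincidence of \<open>B\<close>-orbits.

  For termination, represent a Gaussian rational point by an integral null vector \<open>s\<close>. Reflection in
  the side with normal vector \<open>w\<close> is \<open>s \<mapsto> s - 2\<langle>s,w\<rangle>w\<close>, which is integral again by unimodularity,
  and it strictly decreases the nonnegative integer \<open>-\<langle>s, \<Sum>b<m. t b\<rangle>\<close>. Group elements
  are words in the reflections; the parity of the length decides the orientation, and it can be
  corrected at a vertex by a reflection fixing that vertex. Uniqueness of the vertex follows from orbit
  equivalence, because \<open>B\<close> fixes the vertices.\<close>

section \<open>Reflections of the closed disk\<close>

lemma cnj_unit: "norm (z::complex) = 1 \<Longrightarrow> cnj z = inverse z"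
  by (simp add: inverse_complex_def complex_eq_iff cmod_power2[symmetric])

text \<open>Parallelogram law: the squared lengths of \<open>p + q\<close> and \<open>p - q\<close>
  add up to 4, and the second is positive.\<close>

lemma norm_add_units_less:
  fixes p q :: complex
  assumes "norm p = 1" "norm q = 1" "p \<noteq> q"
  shows "norm (p + q) < 2"
proof -
  have "(norm (p + q))\<^sup>2 + (norm (p - q))\<^sup>2 = 4"
    using assms(1,2)[THEN arg_cong[of _ _ "\<lambda>x. x\<^sup>2"]] unfolding cmod_power2
    by (simp add: power2_eq_square algebra_simps)
  moreover have "(norm (p - q))\<^sup>2 > 0" using assms by simp
  ultimately have "(norm (p + q))\<^sup>2 < 4" by linarith
  then show ?thesis by (intro power2_less_imp_less[of _ 2]) auto
qed

text \<open>A zero would make the product of \<open>norm (p + q) < 2\<close> and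
  \<open>norm z \<le> 1\<close> equal to 2. So the formula makes sense up to the boundary.\<close>

lemma disk_reflection_denominator:
  fixes p q z :: complex
  assumes "norm p = 1" "norm q = 1" "p \<noteq> q" "norm z \<le> 1"
  shows "2 - (p + q) * cnj z \<noteq> 0"
proof
  assume "2 - (p + q) * cnj z = 0"
  then have "(p + q) * cnj z = 2" by simp
  then have "norm (p + q) * norm z = 2" by (metis complex_mod_cnj norm_mult norm_numeral)
  moreover have "norm (p + q) * norm z \<le> norm (p + q) * 1"
    by (rule mult_left_mono) (use assms in auto)
  ultimately show False using norm_add_units_less[OF assms(1-3)] by linarith
qed

lemma circle_reflection_denominator:
  fixes p q z :: complex
  assumes "norm p = 1" "norm q = 1" "p \<noteq> q" "norm z = 1"
  shows "2 * z - (p + q) \<noteq> 0"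
proof
  assume "2 * z - (p + q) = 0"
  then have "norm (p + q) = norm (2 * z)" by simp
  then show False using norm_add_units_less[OF assms(1-3)] assms by (simp add: norm_mult)
qed

lemma disk_reflection_eq_circle_reflection:
  assumes "norm z = 1"
  shows "disk_reflection p q z = circle_reflection p q z"
proof -
  have z: "z \<noteq> 0" using assms by auto
  have "((p + q) - 2 * p * q * cnj z) = ((p + q) * z - 2 * p * q) / z"
    "(2 - (p + q) * cnj z) = (2 * z - (p + q)) / z"
    using z by (simp_all add: cnj_unit[OF assms] field_simps)
  then show ?thesis using z by (simp add: disk_reflection_def circle_reflection_def)
qed

text \<open>Conjugation inverts the unit numbers \<open>p\<close> and \<open>q\<close>, so the
  composite is a rational function of \<open>z\<close>; numerator and denominator share the factor
  \<open>- ((p - q)\<^sup>2)\<close>, which leaves \<open>z\<close>.\<close>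

lemma disk_reflection_involution:
  fixes p q z :: complex
  assumes p: "norm p = 1" and q: "norm q = 1" and pq: "p \<noteq> q" and z: "norm z \<le> 1"
  shows "disk_reflection p q (disk_reflection p q z) = z"
proof -
  have nz: "p \<noteq> 0" "q \<noteq> 0" using p q by auto
  define D where "D = 2 - (p + q) * cnj z"
  define D' where "D' = cnj D"
  have D: "D \<noteq> 0" unfolding D_def by (rule disk_reflection_denominator[OF assms])
  then have D': "D' \<noteq> 0" unfolding D'_def by simp
  have D'_eq: "D' * (p * q) = 2 * p * q - (p + q) * z"
    using nz by (simp add: D'_def D_def cnj_unit[OF p] cnj_unit[OF q] field_simps)
  have N': "cnj (disk_reflection p q z) = ((p + q) - 2 * z) / (2 * p * q - (p + q) * z)"
  proof -
    have "cnj (disk_reflection p q z) = ((inverse p + inverse q) - 2 * inverse p * inverse q * z) / D'"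
      by (simp add: disk_reflection_def D'_def D_def cnj_unit[OF p] cnj_unit[OF q])
    also have "(inverse p + inverse q) - 2 * inverse p * inverse q * z = ((p + q) - 2 * z) / (p * q)"
      using nz by (simp add: field_simps)
    also have "((p + q) - 2 * z) / (p * q) / D' = ((p + q) - 2 * z) / (D' * (p * q))"
      by simp
    finally show ?thesis using D'_eq by simp
  qed
  define E where "E = 2 * p * q - (p + q) * z"
  have E: "E \<noteq> 0" using D'_eq D' nz unfolding E_def by (metis mult_eq_0_iff)
  have "disk_reflection p q (disk_reflection p q z)
      = ((p + q) - 2 * p * q * (((p + q) - 2 * z) / E)) / (2 - (p + q) * (((p + q) - 2 * z) / E))"
    by (simp add: disk_reflection_def[of p q "disk_reflection p q z"] N' E_def)
  also have "\<dots> = ((p + q) * E - 2 * p * q * ((p + q) - 2 * z)) / (2 * E - (p + q) * ((p + q) - 2 * z))"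
    using E by (simp add: divide_simps)
  also have "(p + q) * E - 2 * p * q * ((p + q) - 2 * z) = - (z * (p - q)\<^sup>2)"
    unfolding E_def by algebra
  also have "2 * E - (p + q) * ((p + q) - 2 * z) = - ((p - q)\<^sup>2)"
    unfolding E_def by algebra
  finally show ?thesis using pq by simp
qed

text \<open>One identity serves twice: through the factor \<open>1 - (norm z)\<^sup>2\<close> both
  the open disk and the unit circle are seen to be preserved.\<close>

lemma norm_disk_reflection:
  fixes p q z :: complex
  assumes p: "norm p = 1" and q: "norm q = 1" and pq: "p \<noteq> q" and z: "norm z \<le> 1"
  shows "1 - (norm (disk_reflection p q z))\<^sup>2
    = (4 - (norm (p + q))\<^sup>2) * (1 - (norm z)\<^sup>2) / (norm (2 - (p + q) * cnj z))\<^sup>2"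
proof -
  have nz: "p \<noteq> 0" "q \<noteq> 0" using p q by auto
  define s where "s = p + q"
  have D: "norm (2 - s * cnj z) \<noteq> 0"
    unfolding s_def using disk_reflection_denominator[OF assms] by simp
  \<comment> \<open>This relation makes the numerator a unit multiple of
    \<open>cnj (s - 2 * z)\<close>.\<close>
  have s: "s = p * q * cnj s"
    using nz by (simp add: s_def cnj_unit[OF p] cnj_unit[OF q] field_simps)
  have "norm (s - 2 * p * q * cnj z) = norm (p * q * cnj (s - 2 * z))"
    using s by (metis (no_types, lifting) complex_cnj_diff complex_cnj_mult complex_cnj_numeral mult.assoc mult.left_commute right_diff_distrib')
  then have N: "norm (s - 2 * p * q * cnj z) = norm (s - 2 * z)"
    using p q by (simp only: norm_mult complex_mod_cnj)
  have "(norm (2 - s * cnj z))\<^sup>2 - (norm (s - 2 * z))\<^sup>2 = (4 - (norm s)\<^sup>2) * (1 - (norm z)\<^sup>2)"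
    unfolding cmod_power2 by (simp add: power2_eq_square algebra_simps)
  then show ?thesis
    using D unfolding disk_reflection_def s_def[symmetric] norm_divide N power_divide
    by (simp add: field_simps)
qed

lemma disk_reflection_in_disk:
  fixes p q z :: complex
  assumes "norm p = 1" "norm q = 1" "p \<noteq> q" "norm z < 1"
  shows "norm (disk_reflection p q z) < 1"
proof -
  have "(norm (p + q))\<^sup>2 < 2\<^sup>2"
    by (rule power_strict_mono[OF norm_add_units_less]) (use assms in auto)
  moreover have "(norm z)\<^sup>2 < 1" using assms by (simp add: power_less_one_iff)
  moreover have "norm (2 - (p + q) * cnj z) > 0"
    using disk_reflection_denominator[of p q z] assms by simp
  ultimately have "1 - (norm (disk_reflection p q z))\<^sup>2 > 0"
    using norm_disk_reflection[of p q z] assms by simp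
  then show ?thesis by (simp add: power_less_one_iff)
qed

lemma circle_reflection_on_circle:
  fixes p q z :: complex
  assumes "norm p = 1" "norm q = 1" "p \<noteq> q" "norm z = 1"
  shows "norm (circle_reflection p q z) = 1"
proof -
  have "(norm (disk_reflection p q z))\<^sup>2 = 1"
    using norm_disk_reflection[of p q z] assms by simp
  then show ?thesis
    using assms by (simp add: disk_reflection_eq_circle_reflection power2_eq_1_iff)
       (smt (verit) norm_ge_zero)
qed

lemma continuous_on_disk_reflection:
  fixes p q :: complex
  assumes "norm p = 1" "norm q = 1" "p \<noteq> q"
  shows "continuous_on (cball 0 1) (disk_reflection p q)"
  unfolding disk_reflection_def
  by (intro continuous_intros ballI disk_reflection_denominator) (use assms in auto)

text \<open>The reflection is a Moebius transformation \<open>f\<close> applied to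
  \<open>cnj z\<close>, hence antiholomorphic.\<close>

lemma disk_reflection_has_derivative:
  fixes p q z :: complex
  assumes "norm p = 1" "norm q = 1" "p \<noteq> q" "norm z < 1"
  shows "\<exists>c. c \<noteq> 0 \<and> (disk_reflection p q has_derivative (\<lambda>h. c * cnj h)) (at z)"
proof -
  define f where "f = (\<lambda>w. ((p + q) - 2 * p * q * w) / (2 - (p + q) * w))"
  define c where "c = (p - q)\<^sup>2 / (2 - (p + q) * cnj z)\<^sup>2"
  have D: "2 - (p + q) * cnj z \<noteq> 0"
    by (rule disk_reflection_denominator) (use assms in auto)
  have "(f has_field_derivative c) (at (cnj z))"
    unfolding f_def c_def
    by (rule derivative_eq_intros refl D)+ (use D in \<open>simp add: field_simps power2_eq_square\<close>)
  moreover have "(cnj has_derivative cnj) (at z)"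
    by (rule bounded_linear_imp_has_derivative) (rule bounded_linear_cnj)
  ultimately have "((\<lambda>x. f (cnj x)) has_derivative (\<lambda>h. c * cnj h)) (at z)"
    by (metis has_derivative_compose has_field_derivative_def)
  moreover have "c \<noteq> 0" using D assms by (simp add: c_def)
  moreover have "(\<lambda>x. f (cnj x)) = disk_reflection p q"
    by (simp add: f_def disk_reflection_def fun_eq_iff)
  ultimately show ?thesis by auto
qed

lemma circle_reflection_left: "p \<noteq> q \<Longrightarrow> circle_reflection p q p = p"
  unfolding circle_reflection_def by (simp add: field_simps)

lemma circle_reflection_right: "p \<noteq> q \<Longrightarrow> circle_reflection p q q = q"
  unfolding circle_reflection_def by (simp add: field_simps)

section \<open>Position relative to an arc\<close>

text \<open>In complex coordinates, \<open>arc_side p q z\<close> is the Lorentz product of \<open>(Re z, Im z, 1)\<close> with the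
  unit normal vector of the geodesic from \<open>p\<close> to \<open>q\<close> (for rational end points, the arc vector),
  and \<open>stretch p q z\<close> is the last coordinate of the image of \<open>(Re z, Im z, 1)\<close> under the Lorentz
  reflection along this normal vector.\<close>

definition arc_side :: "complex \<Rightarrow> complex \<Rightarrow> complex \<Rightarrow> real" where
  "arc_side p q z = Re (\<i> * (z - p) * (z - q) / ((q - p) * z))"

lemma cis_double_minus_1: "cis (2 * x) - 1 = 2 * \<i> * sin x * cis x"
  by (simp add: complex_eq_iff cos_double_sin sin_double power2_eq_square)

lemma unit_eq_cis_Arg2pi: "norm z = 1 \<Longrightarrow> z = cis (Arg2pi z)"
  using Arg2pi_eq[of z] by (simp add: cis_conv_exp)

text \<open>Doubled angles turn every difference of points into a sine times a phase. The phases
  cancel, which leaves a real number whose sign can be read off.\<close>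

lemma arc_side_cis:
  assumes "p \<noteq> 0" "sin b \<noteq> 0"
  shows "\<i> * (p * cis (2 * a) - p) * (p * cis (2 * a) - p * cis (2 * b)) / ((p * cis (2 * b) - p) * (p * cis (2 * a)))
    = of_real (2 * sin a * sin (b - a) / sin b)"
proof -
  have e: "cis (2 * b) = cis (2 * a) * cis (2 * (b - a))" "cis b = cis a * cis (b - a)"
    by (simp_all add: cis_mult)
  have "p * cis (2 * a) - p = p * (cis (2 * a) - 1)"
    "p * cis (2 * b) - p = p * (cis (2 * b) - 1)"
    "p * cis (2 * a) - p * cis (2 * b) = - (p * cis (2 * a) * (cis (2 * (b - a)) - 1))"
    by (simp_all add: e(1) right_diff_distrib)
  note eqs = this[unfolded cis_double_minus_1 e(2)]
  show ?thesis unfolding eqs using assms by (simp add: divide_simps)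
qed

text \<open>Apply \<open>arc_side_cis\<close> to the half angles of \<open>z / p\<close> and
  \<open>q / p\<close>. These lie in \<open>[0, pi)\<close>, so away from \<open>z = p\<close> the
  sign is that of \<open>sin ((\<beta> - \<alpha>) / 2)\<close>.\<close>

lemma
  fixes p q z :: complex
  assumes "norm p = 1" "norm q = 1" "norm z = 1" "p \<noteq> q"
  shows of_real_arc_side:
      "complex_of_real (arc_side p q z) = \<i> * (z - p) * (z - q) / ((q - p) * z)"
    and arc_side_pos_iff: "arc_side p q z > 0 \<longleftrightarrow> z \<in> ccw_arc p q \<and> z \<noteq> p"
proof -
  define \<alpha> \<beta> where "\<alpha> = Arg2pi (z / p)" and "\<beta> = Arg2pi (q / p)"
  have p: "p \<noteq> 0" using assms by auto
  have zp: "z / p = cis \<alpha>" and qp: "q / p = cis \<beta>"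
    unfolding \<alpha>_def \<beta>_def using assms by (auto intro!: unit_eq_cis_Arg2pi simp: norm_divide)
  have z: "z = p * cis (2 * (\<alpha> / 2))" and q: "q = p * cis (2 * (\<beta> / 2))"
    using p zp qp by (auto simp: field_simps)
  have \<alpha>: "0 \<le> \<alpha>" "\<alpha> < 2 * pi" and \<beta>: "0 \<le> \<beta>" "\<beta> < 2 * pi"
    by (auto simp: \<alpha>_def \<beta>_def Arg2pi_ge_0 Arg2pi_lt_2pi)
  have "\<beta> \<noteq> 0" using q assms by auto
  then have s\<beta>: "sin (\<beta> / 2) > 0" using \<beta> by (intro sin_gt_zero) auto
  have eq: "\<i> * (z - p) * (z - q) / ((q - p) * z)
      = of_real (2 * sin (\<alpha> / 2) * sin ((\<beta> - \<alpha>) / 2) / sin (\<beta> / 2))"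
    using arc_side_cis[OF p, of "\<beta> / 2" "\<alpha> / 2"] s\<beta> unfolding z[symmetric] q[symmetric]
    by (simp add: diff_divide_distrib)
  then show "complex_of_real (arc_side p q z) = \<i> * (z - p) * (z - q) / ((q - p) * z)"
    by (simp add: arc_side_def)
  have side: "arc_side p q z = 2 * sin (\<alpha> / 2) * sin ((\<beta> - \<alpha>) / 2) / sin (\<beta> / 2)"
    unfolding arc_side_def eq by simp
  have "z = p \<longleftrightarrow> \<alpha> = 0"
    using z p \<alpha>_def Arg2pi_of_real[of 1] by auto
  moreover have "z \<in> ccw_arc p q \<longleftrightarrow> \<alpha> < \<beta>"
    using assms by (simp add: ccw_arc_def \<alpha>_def \<beta>_def)
  moreover have "arc_side p q z > 0 \<longleftrightarrow> \<alpha> \<noteq> 0 \<and> \<alpha> < \<beta>"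
  proof (cases "\<alpha> = 0")
    case False
    then have "sin (\<alpha> / 2) > 0" using \<alpha> by (intro sin_gt_zero) auto
    moreover have "sin ((\<beta> - \<alpha>) / 2) > 0 \<longleftrightarrow> \<alpha> < \<beta>"
    proof (cases "\<alpha> < \<beta>")
      case True
      then have "sin ((\<beta> - \<alpha>) / 2) > 0" using \<alpha> \<beta> by (intro sin_gt_zero) auto
      with True show ?thesis by simp
    next
      case False
      then have "sin ((\<alpha> - \<beta>) / 2) \<ge> 0" using \<alpha> \<beta> by (intro sin_ge_zero) auto
      moreover have "sin ((\<beta> - \<alpha>) / 2) = - sin ((\<alpha> - \<beta>) / 2)"
        using sin_minus[of "(\<alpha> - \<beta>) / 2"] by (simp add: minus_divide_left)
      ultimately show ?thesis using False by simp
    qed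
    ultimately show ?thesis using False s\<beta>
      by (auto simp: side zero_less_divide_iff zero_less_mult_iff)
  qed (simp add: side)
  ultimately show "arc_side p q z > 0 \<longleftrightarrow> z \<in> ccw_arc p q \<and> z \<noteq> p" by blast
qed

lemma arc_side_eq_0_iff:
  fixes p q z :: complex
  assumes "norm p = 1" "norm q = 1" "norm z = 1" "p \<noteq> q"
  shows "arc_side p q z = 0 \<longleftrightarrow> z = p \<or> z = q"
proof -
  have "arc_side p q z = 0 \<longleftrightarrow> complex_of_real (arc_side p q z) = 0" by simp
  also have "\<dots> \<longleftrightarrow> z = p \<or> z = q"
    unfolding of_real_arc_side[OF assms] using assms by auto
  finally show ?thesis .
qed

definition stretch :: "complex \<Rightarrow> complex \<Rightarrow> complex \<Rightarrow> real" where
  "stretch p q z = (norm (2 * z - (p + q)) / norm (q - p))\<^sup>2"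

lemma stretch_pos:
  fixes p q z :: complex
  assumes "norm p = 1" "norm q = 1" "norm z = 1" "p \<noteq> q"
  shows "stretch p q z > 0"
  unfolding stretch_def using circle_reflection_denominator[of p q z] assms by simp

text \<open>Conjugation is inversion on the circle, so the squared norms become rational functions,
  and later identities about \<open>stretch\<close> reduce to polynomial ones.\<close>

lemma of_real_stretch:
  fixes p q z :: complex
  assumes p: "norm p = 1" and q: "norm q = 1" and z: "norm z = 1" and "p \<noteq> q"
  shows "complex_of_real (stretch p q z) = (2 * z - (p + q)) * ((p + q) * z - 2 * p * q) / (z * (q - p)\<^sup>2)"
proof -
  have nz: "p \<noteq> 0" "q \<noteq> 0" "z \<noteq> 0" using p q z by auto
  have qp: "q - p \<noteq> 0" using assms by simp
  have 1: "of_real ((norm (2 * z - (p + q)))\<^sup>2) = - (2 * z - (p + q)) * ((p + q) * z - 2 * p * q) / (p * q * z)"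
    unfolding complex_norm_square using nz
    by (simp add: cnj_unit[OF p] cnj_unit[OF q] cnj_unit[OF z] field_simps)
  have 2: "of_real ((norm (q - p))\<^sup>2) = - (q - p)\<^sup>2 / (p * q)"
    unfolding complex_norm_square using nz
    by (simp add: cnj_unit[OF p] cnj_unit[OF q] field_simps power2_eq_square)
  show ?thesis unfolding stretch_def power_divide of_real_divide 1 2
    using nz qp by (simp add: field_simps)
qed

lemma circle_reflection_mult_stretch:
  fixes p q z :: complex
  assumes "norm p = 1" "norm q = 1" "norm z = 1" "p \<noteq> q"
  shows "circle_reflection p q z * stretch p q z = ((p + q) * z - 2 * p * q)\<^sup>2 / (z * (q - p)\<^sup>2)"
  unfolding of_real_stretch[OF assms] circle_reflection_def
  using circle_reflection_denominator[of p q z] assms by (simp add: power2_eq_square)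

text \<open>A Lorentz reflection negates the product with its normal vector; \<open>stretch\<close>
  accounts for rescaling the image to last coordinate 1.\<close>

lemma arc_side_circle_reflection:
  fixes p q z :: complex
  assumes "norm p = 1" "norm q = 1" "norm z = 1" "p \<noteq> q"
  shows "arc_side p q (circle_reflection p q z) * stretch p q z = - arc_side p q z"
proof -
  define r where "r = circle_reflection p q z"
  have r: "norm r = 1" unfolding r_def using circle_reflection_on_circle assms by simp
  have D: "2 * z - (p + q) \<noteq> 0" using circle_reflection_denominator assms by simp
  have nz: "z \<noteq> 0" "r \<noteq> 0" "q - p \<noteq> 0" using assms r by auto
  have rD: "r * (2 * z - (p + q)) = (p + q) * z - 2 * p * q"
    unfolding r_def circle_reflection_def using D by simp
  have 1: "(r - p) * (2 * z - (p + q)) = (q - p) * (z - p)"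
    and 2: "(r - q) * (2 * z - (p + q)) = (p - q) * (z - q)"
    using rD by (simp_all add: algebra_simps)
  have "complex_of_real (arc_side p q r * stretch p q z)
      = \<i> * ((r - p) * (2 * z - (p + q))) * ((r - q) * (2 * z - (p + q))) / ((q - p) * (z * (q - p)\<^sup>2))"
    unfolding of_real_mult of_real_arc_side[OF assms(1,2) r assms(4)] of_real_stretch[OF assms]
      rD[symmetric] using nz by simp
  also have "\<dots> = - (\<i> * (z - p) * (z - q) / ((q - p) * z))"
    unfolding 1 2 using nz by (simp add: divide_simps power2_eq_square) algebra
  also have "\<dots> = complex_of_real (- arc_side p q z)"
    by (simp add: of_real_arc_side[OF assms])
  finally show ?thesis unfolding r_def of_real_eq_iff .
qed

lemma left_end_mem_ccw_arc:
  fixes p q :: complex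
  assumes "norm p = 1" "norm q = 1" "p \<noteq> q"
  shows "p \<in> ccw_arc p q"
proof -
  have "Arg2pi (q / p) \<noteq> 0"
    using unit_eq_cis_Arg2pi[of "q / p"] assms by (auto simp: norm_divide)
  moreover have "p \<noteq> 0" using assms by auto
  ultimately show ?thesis using assms Arg2pi_ge_0[of "q / p"] Arg2pi_of_real[of 1]
    by (simp add: ccw_arc_def less_le)
qed

text \<open>Off the arc and its right end \<open>arc_side\<close> is negative, and the reflection
  flips its sign because \<open>stretch\<close> is positive.\<close>

lemma circle_reflection_in_arc:
  fixes p q z :: complex
  assumes "norm p = 1" "norm q = 1" "norm z = 1" "p \<noteq> q" "z \<notin> ccw_arc p q" "z \<noteq> q"
  shows "circle_reflection p q z \<in> ccw_arc p q"
proof -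
  have "arc_side p q z \<noteq> 0"
    using assms arc_side_eq_0_iff left_end_mem_ccw_arc[of p q] by auto
  moreover have "\<not> arc_side p q z > 0" using assms arc_side_pos_iff by simp
  ultimately have "arc_side p q (circle_reflection p q z) * stretch p q z > 0"
    using arc_side_circle_reflection assms by simp
  then have "arc_side p q (circle_reflection p q z) > 0"
    using stretch_pos[of p q z] assms by (simp add: zero_less_mult_iff)
  then show ?thesis using arc_side_pos_iff circle_reflection_on_circle assms by simp
qed

section \<open>Arc vectors\<close>

lemma circle_point_eq_Complex:
  "circle_point t = Complex (t $ 1 / t $ 3) (t $ 2 / t $ 3)"
proof -
  have eq: "of_int (t $ 1) + of_int (t $ 2) * \<i> = Complex (t $ 1) (t $ 2)"
    "of_int (t $ 3) = complex_of_real (of_int (t $ 3))"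
    by (simp_all add: complex_eq_iff)
  then show ?thesis
    unfolding circle_point_def eq
    by (simp only: complex_eq_iff Re_divide_of_real Im_divide_of_real complex.sel)
qed

lemma norm_Complex_divide:
  fixes x y r :: real
  assumes "x\<^sup>2 + y\<^sup>2 = r\<^sup>2" "r > 0"
  shows "norm (Complex (x / r) (y / r)) = 1"
proof -
  have "(x / r)\<^sup>2 + (y / r)\<^sup>2 = 1"
    using assms by (simp add: power_divide flip: add_divide_distrib)
  then show ?thesis by (simp add: complex_norm)
qed

lemma norm_circle_point: "pythagorean_triple t \<Longrightarrow> norm (circle_point t) = 1"
  unfolding circle_point_eq_Complex pythagorean_triple_def
  by (intro norm_Complex_divide) (auto simp flip: of_int_power of_int_add)

text \<open>The last coordinates of \<open>t\<close> and \<open>t'\<close> scale the cross product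
  and the Lorentz product alike and cancel, so the arc vector is a function of the two circle
  points.\<close>

lemma arc_vector_nth:
  fixes t t' :: "int ^ 3"
  assumes "t $ 3 > 0" "t' $ 3 > 0"
  defines "p \<equiv> circle_point t" and "q \<equiv> circle_point t'"
  shows "arc_vector t t' $ 1 = (Im p - Im q) / (Re p * Re q + Im p * Im q - 1)"
    and "arc_vector t t' $ 2 = (Re q - Re p) / (Re p * Re q + Im p * Im q - 1)"
    and "arc_vector t t' $ 3 = (Re q * Im p - Re p * Im q) / (Re p * Re q + Im p * Im q - 1)"
proof -
  define l where "l = Re p * Re q + Im p * Im q - 1"
  define r r' where "r = real_of_int (t $ 3)" and "r' = real_of_int (t' $ 3)"
  have r: "r \<noteq> 0" "r' \<noteq> 0" using assms by (auto simp: r_def r'_def)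
  have t: "real_of_int (t $ 1) = r * Re p" "real_of_int (t $ 2) = r * Im p"
    "real_of_int (t' $ 1) = r' * Re q" "real_of_int (t' $ 2) = r' * Im q"
    using assms by (simp_all add: r_def r'_def circle_point_eq_Complex)
  have L: "lorentz_matrix *v x = vector [x $ 1, x $ 2, - x $ 3]" for x
    by (simp add: lorentz_matrix_def vec_eq_iff forall_3 matrix_vector_mult_def sum_3)
  have "lorentz (real_vec t') (real_vec t) = r * r' * l"
    by (simp add: lorentz_def L inner_vec_def sum_3 real_vec_def t r_def[symmetric] r'_def[symmetric]
        l_def algebra_simps)
  moreover have "cross3 (lorentz_matrix *v real_vec t') (lorentz_matrix *v real_vec t) =
      vector [r * r' * (Im p - Im q), r * r' * (Re q - Re p), r * r' * (Re q * Im p - Re p * Im q)]"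
    by (simp add: cross3_def L real_vec_def t r_def[symmetric] r'_def[symmetric] vec_eq_iff forall_3
        algebra_simps)
  ultimately show "arc_vector t t' $ 1 = (Im p - Im q) / l" "arc_vector t t' $ 2 = (Re q - Re p) / l"
    "arc_vector t t' $ 3 = (Re q * Im p - Re p * Im q) / l"
    using r by (simp_all add: arc_vector_def)
qed

locale unimodular_arc_ends =
  fixes t t' :: "int ^ 3" and p q :: complex
  assumes pyth: "pythagorean_triple t" "pythagorean_triple t'"
    and ends: "p = circle_point t" "q = circle_point t'" "p \<noteq> q"
begin

lemma norm_ends: "norm p = 1" "norm q = 1"
  using pyth ends norm_circle_point by auto

lemma ends_nonzero: "p \<noteq> 0" "q \<noteq> 0" "q - p \<noteq> 0"
  using norm_ends ends by auto

text \<open>In complex form the later identities are rational in \<open>p\<close>, \<open>q\<close>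
  and \<open>z\<close>. Here \<open>l\<close> is the Lorentz product of the end points lifted to
  last coordinate 1; it equals \<open>(q - p)\<^sup>2 / (2 * p * q)\<close>.\<close>

lemma
  shows arc_vector_complex:
      "Complex (arc_vector t t' $ 1) (arc_vector t t' $ 2) = 2 * \<i> * p * q / (q - p)"
    and arc_vector_3: "complex_of_real (arc_vector t t' $ 3) = \<i> * (p + q) / (q - p)"
proof -
  define l where "l = Re p * Re q + Im p * Im q - 1"
  have "p * cnj q + q * cnj p = 2 * complex_of_real (Re p * Re q + Im p * Im q)"
    by (simp add: complex_eq_iff)
  then have l: "complex_of_real l = (q - p)\<^sup>2 / (2 * p * q)"
    using ends_nonzero unfolding cnj_unit[OF norm_ends(1)] cnj_unit[OF norm_ends(2)]
    by (simp add: l_def field_simps power2_eq_square)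
  have t3: "t $ 3 > 0" "t' $ 3 > 0" using pyth by (auto simp: pythagorean_triple_def)
  note w = arc_vector_nth[OF t3, folded ends(1,2), folded l_def]
  have "Complex (arc_vector t t' $ 1) (arc_vector t t' $ 2) = \<i> * (q - p) / of_real l"
    unfolding w by (simp add: complex_eq_iff Re_divide_of_real Im_divide_of_real)
  then show "Complex (arc_vector t t' $ 1) (arc_vector t t' $ 2) = 2 * \<i> * p * q / (q - p)"
    unfolding l using ends_nonzero by (simp add: divide_simps power2_eq_square)
  have "p * cnj q - q * cnj p = 2 * \<i> * complex_of_real (Re q * Im p - Re p * Im q)"
    by (simp add: complex_eq_iff)
  then have "complex_of_real (Re q * Im p - Re p * Im q) = (p * p - q * q) / (2 * \<i> * p * q)"
    using ends_nonzero unfolding cnj_unit[OF norm_ends(1)] cnj_unit[OF norm_ends(2)]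
    by (simp add: field_simps)
  then have "complex_of_real (arc_vector t t' $ 3) = (p * p - q * q) / (2 * \<i> * p * q) / of_real l"
    unfolding w by (simp only: of_real_divide)
  also have "\<dots> = \<i> * (p + q) / (q - p)"
    unfolding l using ends_nonzero by (simp add: divide_simps power2_eq_square) algebra
  finally show "complex_of_real (arc_vector t t' $ 3) = \<i> * (p + q) / (q - p)" .
qed

lemma lorentz_arc_vector:
  assumes z: "norm z = 1"
  shows "Re z * arc_vector t t' $ 1 + Im z * arc_vector t t' $ 2 - arc_vector t t' $ 3 = arc_side p q z"
proof -
  define W where "W = Complex (arc_vector t t' $ 1) (arc_vector t t' $ 2)"
  have nz: "z \<noteq> 0" using z by auto
  have W: "W = 2 * \<i> * p * q / (q - p)" unfolding W_def by (rule arc_vector_complex)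
  have "cnj W = - 2 * \<i> * inverse p * inverse q / (inverse q - inverse p)"
    unfolding W by (simp add: cnj_unit[OF norm_ends(1)] cnj_unit[OF norm_ends(2)])
  also have "inverse q - inverse p = - (q - p) / (p * q)"
    using ends_nonzero by (simp add: field_simps)
  finally have cW: "cnj W = 2 * \<i> / (q - p)" using ends_nonzero by (simp add: divide_simps) algebra
  have "complex_of_real (Re z * arc_vector t t' $ 1 + Im z * arc_vector t t' $ 2)
      = (z * cnj W + cnj z * W) / 2"
    by (simp add: complex_eq_iff W_def)
  then have "complex_of_real (Re z * arc_vector t t' $ 1 + Im z * arc_vector t t' $ 2 - arc_vector t t' $ 3)
      = (z * cnj W + inverse z * W) / 2 - \<i> * (p + q) / (q - p)"
    unfolding of_real_diff arc_vector_3 cnj_unit[OF z] by simp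
  also have "\<dots> = complex_of_real (arc_side p q z)"
    unfolding of_real_arc_side[OF norm_ends z ends(3)] cW unfolding W
    using ends_nonzero nz by (simp add: divide_simps) algebra
  finally show ?thesis unfolding of_real_eq_iff .
qed

lemma stretch_arc_vector:
  assumes z: "norm z = 1"
  shows "stretch p q z = 1 - 2 * arc_side p q z * arc_vector t t' $ 3"
proof -
  have "z \<noteq> 0" using z by auto
  then have "complex_of_real (stretch p q z) = 1 - 2 * arc_side p q z * arc_vector t t' $ 3"
    unfolding of_real_diff of_real_mult arc_vector_3 of_real_arc_side[OF norm_ends z ends(3)]
      of_real_stretch[OF norm_ends z ends(3)]
    using ends_nonzero by (simp add: divide_simps power2_eq_square) (use i_squared in algebra)
  then show ?thesis unfolding of_real_eq_iff .
qed

text \<open>Together with \<open>stretch_arc_vector\<close> this says that the Lorentz reflection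
  along the arc vector sends \<open>(Re z, Im z, 1)\<close> to \<open>stretch p q z\<close> times
  the lift of the reflected point. It links the map on the circle to integral vectors.\<close>

lemma circle_reflection_arc_vector:
  assumes z: "norm z = 1"
  shows "circle_reflection p q z * stretch p q z
    = z - 2 * arc_side p q z * Complex (arc_vector t t' $ 1) (arc_vector t t' $ 2)"
proof -
  have "z \<noteq> 0" using z by auto
  then show ?thesis
    unfolding arc_vector_complex of_real_mult of_real_arc_side[OF norm_ends z ends(3)]
      circle_reflection_mult_stretch[OF norm_ends z ends(3)]
    using ends_nonzero by (simp add: divide_simps power2_eq_square) (use i_squared in algebra)
qed

end

section \<open>Change of base point for angles, null vectors, rational points\<close>

lemma Arg2pi_divide_if:
  assumes "w \<noteq> 0" "z \<noteq> 0"
  shows "Arg2pi (z / w) = (if Arg2pi w \<le> Arg2pi z then Arg2pi z - Arg2pi w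
    else Arg2pi z - Arg2pi w + 2 * pi)"
proof (cases "Arg2pi w \<le> Arg2pi z")
  case False
  then have "Arg2pi (w / z) = Arg2pi w - Arg2pi z" using assms Arg2pi_divide by simp
  \<comment> \<open>The inversion formula treats real quotients separately; the angle here is
    positive, so only \<open>pi\<close> remains, and \<open>pi = 2 * pi - pi\<close>.\<close>
  moreover have "w / z \<in> \<real> \<longleftrightarrow> Arg2pi (w / z) = 0 \<or> Arg2pi (w / z) = pi"
    using Arg2pi_eq_0_pi by blast
  ultimately have "Arg2pi (inverse (w / z)) = 2 * pi - (Arg2pi w - Arg2pi z)"
    using Arg2pi_inverse[of "w / z"] assms False by (auto split: if_splits)
  then show ?thesis using False by simp
qed (use assms Arg2pi_divide in auto)

text \<open>Cauchy-Schwarz in the plane, by the Lagrange identity. In Lorentz terms, two null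
  vectors with positive last coordinate have nonpositive product, which keeps the descent height
  nonnegative.\<close>

lemma lorentz_nonpos:
  fixes x y r a b c :: int
  assumes "x\<^sup>2 + y\<^sup>2 = r\<^sup>2" "r > 0" "a\<^sup>2 + b\<^sup>2 = c\<^sup>2" "c > 0"
  shows "x * a + y * b \<le> r * c"
proof -
  have "(x * a + y * b)\<^sup>2 + (x * b - y * a)\<^sup>2 = (r * c)\<^sup>2"
    unfolding power_mult_distrib assms(1,3)[symmetric] by (simp add: power2_eq_square algebra_simps)
  then have "(x * a + y * b)\<^sup>2 \<le> (r * c)\<^sup>2" using zero_le_power2[of "x * b - y * a"] by linarith
  then show ?thesis by (rule power2_le_imp_le) (use assms(2,4) in simp)
qed

lemma gaussian_rational_on_circle:
  assumes "norm \<sigma> = 1" "\<sigma> \<in> gaussian_rationals"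
  obtains x y r :: int where "r > 0" "\<sigma> = Complex (x / r) (y / r)" "x\<^sup>2 + y\<^sup>2 = r\<^sup>2"
proof -
  from assms have "Re \<sigma> \<in> \<rat>" "Im \<sigma> \<in> \<rat>" by (auto simp: gaussian_rationals_def)
  then obtain a b c d :: int where ab: "b > 0" "Re \<sigma> = a / b" and cd: "d > 0" "Im \<sigma> = c / d"
    by (metis Rats_cases')
  define x y r where "x = a * d" and "y = c * b" and "r = b * d"
  have r: "r > 0" using ab cd by (simp add: r_def)
  have \<sigma>: "\<sigma> = Complex (x / r) (y / r)"
    using ab cd by (simp add: complex_eq_iff x_def y_def r_def)
  have "(x / r)\<^sup>2 + (y / r)\<^sup>2 = 1"
    using assms(1) unfolding \<sigma> by (simp add: complex_norm)
  then have "real_of_int (x\<^sup>2 + y\<^sup>2) = real_of_int (r\<^sup>2)"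
    using r by (simp add: field_simps)
  then have "x\<^sup>2 + y\<^sup>2 = r\<^sup>2" unfolding of_int_eq_iff .
  with that r \<sigma> show ?thesis by blast
qed

section \<open>The billiard map and the groups\<close>

locale billiard_table =
  fixes m :: nat and t :: "nat \<Rightarrow> int ^ 3"
  assumes partition: "unimodular_partition m t"
begin

abbreviation v :: "nat \<Rightarrow> complex" where "v \<equiv> vertex m t"

abbreviation next_index :: "nat \<Rightarrow> nat" where "next_index a \<equiv> Suc a mod m"

abbreviation side :: "nat \<Rightarrow> complex \<Rightarrow> complex" where
  "side a \<equiv> disk_reflection (v a) (v (Suc a))"

lemma m: "m \<ge> 3"
  using partition by (simp add: unimodular_partition_def)

lemma triple: "a < m \<Longrightarrow> pythagorean_triple (t a)"
  using partition by (simp add: unimodular_partition_def)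

lemma vertex_less: "a < m \<Longrightarrow> v a = circle_point (t a)"
  by (simp add: vertex_def)

lemma vertex_Suc: "v (Suc a) = v (next_index a)" "v (Suc a) = circle_point (t (next_index a))"
  by (simp_all add: vertex_def)

lemma next_index_less: "next_index a < m"
  using m by simp

lemma next_index_eq: "a < m \<Longrightarrow> next_index a = (if Suc a < m then Suc a else 0)"
  by (auto simp: mod_Suc)

lemma norm_vertex: "norm (v a) = 1"
  using m by (simp add: vertex_def norm_circle_point triple)

lemma Arg2pi_vertex_mono:
  assumes "b < c" "c < m"
  shows "Arg2pi (v b / v 0) < Arg2pi (v c / v 0)"
  using partition assms strict_mono_onD[of "{..<m}" "\<lambda>a. Arg2pi (v a / v 0)" b c]
  by (simp add: unimodular_partition_def ccw_cyclically_ordered_def)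

lemma vertex_inj: "a < m \<Longrightarrow> b < m \<Longrightarrow> v a = v b \<Longrightarrow> a = b"
  using Arg2pi_vertex_mono[of a b] Arg2pi_vertex_mono[of b a] by (cases a b rule: linorder_cases) auto

lemma vertex_neq_Suc: "a < m \<Longrightarrow> v a \<noteq> v (Suc a)"
  using vertex_inj[OF _ next_index_less, of a a] m unfolding vertex_Suc(1)
  by (auto simp: next_index_eq split: if_splits)

lemmas side_ends = norm_vertex norm_vertex vertex_neq_Suc

text \<open>All angles are measured from \<open>v 0\<close>. The last arc ends at
  \<open>v 0\<close>, whose angle is 0 rather than a full turn, so there the upper bound
  disappears.\<close>

lemma mem_arc_iff:
  assumes a: "a < m" and \<sigma>: "norm \<sigma> = 1"
  shows "\<sigma> \<in> ccw_arc (v a) (v (Suc a)) \<longleftrightarrow>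
    Arg2pi (v a / v 0) \<le> Arg2pi (\<sigma> / v 0) \<and>
    (Suc a < m \<longrightarrow> Arg2pi (\<sigma> / v 0) < Arg2pi (v (Suc a) / v 0))"
proof -
  define A where "A = (\<lambda>z. Arg2pi (z / v 0))"
  have A_eq: "Arg2pi (z / v 0) = A z" for z by (simp add: A_def)
  have nz: "v b \<noteq> 0" for b using norm_vertex[of b] by auto
  have \<sigma>0: "\<sigma> \<noteq> 0" using \<sigma> by auto
  have A: "Arg2pi (z / v a) = (if A (v a) \<le> A z then A z - A (v a) else A z - A (v a) + 2 * pi)"
    if "z \<noteq> 0" for z
    using Arg2pi_divide_if[of "v a / v 0" "z / v 0"] nz that by (simp add: A_def)
  have A_bounds: "0 \<le> A z" "A z < 2 * pi" for z
    by (simp_all add: A_def Arg2pi_ge_0 Arg2pi_lt_2pi)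
  have A_0: "A (v 0) = 0" using nz[of 0] Arg2pi_of_real[of 1] by (simp add: A_def)
  have A_mono: "A (v b) < A (v c)" if "b < c" "c < m" for b c
    using Arg2pi_vertex_mono that by (simp add: A_def)
  have mem: "\<sigma> \<in> ccw_arc (v a) (v (Suc a)) \<longleftrightarrow> Arg2pi (\<sigma> / v a) < Arg2pi (v (Suc a) / v a)"
    using \<sigma> by (simp add: ccw_arc_def)
  show ?thesis
  proof (cases "Suc a < m")
    case True
    then have "A (v a) < A (v (Suc a))" by (intro A_mono) auto
    then show ?thesis
      unfolding mem A[OF \<sigma>0] A[OF nz]
      using True A_bounds(1)[of \<sigma>] A_bounds(2)[of "v (Suc a)"] unfolding A_eq by auto
  next
    case False
    then have "Suc a = m" using a by simp
    then have "v (Suc a) = v 0" by (simp add: vertex_def)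
    moreover have "A (v a) > 0" using A_mono[of 0 a] A_0 \<open>Suc a = m\<close> m by auto
    ultimately show ?thesis
      unfolding mem A[OF \<sigma>0] A[OF nz]
      using False A_0 A_bounds[of \<sigma>] unfolding A_eq by auto
  qed
qed

text \<open>The arc starts at the last vertex met no later than \<open>\<sigma>\<close> on the turn
  from \<open>v 0\<close>; maximality of its index is the upper bound in
  \<open>mem_arc_iff\<close>.\<close>

lemma ex1_arc:
  assumes \<sigma>: "norm \<sigma> = 1"
  shows "\<exists>!a. a < m \<and> \<sigma> \<in> ccw_arc (v a) (v (Suc a))"
proof (rule ex_ex1I)
  define S where "S = {a. a < m \<and> Arg2pi (v a / v 0) \<le> Arg2pi (\<sigma> / v 0)}"
  have "v 0 \<noteq> 0" using norm_vertex[of 0] by auto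
  then have "0 \<in> S"
    using m Arg2pi_of_real[of 1] by (simp add: S_def Arg2pi_ge_0)
  have fin: "finite S" by (simp add: S_def)
  define a where "a = Max S"
  have a: "a \<in> S" unfolding a_def using fin \<open>0 \<in> S\<close> by (intro Max_in) auto
  have "Suc a \<notin> S" using Max_ge[OF fin, of "Suc a"] by (auto simp: a_def)
  with a have "a < m \<and> \<sigma> \<in> ccw_arc (v a) (v (Suc a))"
    using \<sigma> by (auto simp: S_def mem_arc_iff)
  then show "\<exists>a. a < m \<and> \<sigma> \<in> ccw_arc (v a) (v (Suc a))" ..
next
  have le: "b \<le> a" if a: "a < m" "\<sigma> \<in> ccw_arc (v a) (v (Suc a))"
    and b: "b < m" "\<sigma> \<in> ccw_arc (v b) (v (Suc b))" for a b
  proof (rule ccontr)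
    assume "\<not> b \<le> a"
    then have "Suc a \<le> b" by simp
    then have "Arg2pi (v (Suc a) / v 0) \<le> Arg2pi (v b / v 0)"
      using Arg2pi_vertex_mono[of "Suc a" b] b(1) by (cases "Suc a = b") auto
    then show False using a b \<open>Suc a \<le> b\<close> \<sigma> by (auto simp: mem_arc_iff)
  qed
  fix a b
  assume "a < m \<and> \<sigma> \<in> ccw_arc (v a) (v (Suc a))" "b < m \<and> \<sigma> \<in> ccw_arc (v b) (v (Suc b))"
  then show "a = b" using le by (meson order_antisym)
qed

lemma billiard_map_eq:
  assumes "a < m" "\<sigma> \<in> ccw_arc (v a) (v (Suc a))"
  shows "billiard_map m t \<sigma> = side a \<sigma>"
proof -
  have \<sigma>: "norm \<sigma> = 1" using assms by (simp add: ccw_arc_def)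
  have "(THE a. a < m \<and> \<sigma> \<in> ccw_arc (v a) (v (Suc a))) = a"
    using assms ex1_arc[OF \<sigma>] by (intro the1_equality) auto
  then show ?thesis
    by (simp add: billiard_map_def disk_reflection_eq_circle_reflection \<sigma>)
qed

lemma vertex_mem_arc: "a < m \<Longrightarrow> v a \<in> ccw_arc (v a) (v (Suc a))"
proof -
  assume "a < m"
  then show ?thesis
    using left_end_mem_ccw_arc[OF side_ends] by simp
qed

lemma side_vertex: "a < m \<Longrightarrow> side a (v a) = v a" "a < m \<Longrightarrow> side a (v (Suc a)) = v (Suc a)"
  by (simp_all add: disk_reflection_eq_circle_reflection norm_vertex circle_reflection_left
      circle_reflection_right vertex_neq_Suc)

lemma norm_side: "a < m \<Longrightarrow> norm \<sigma> = 1 \<Longrightarrow> norm (side a \<sigma>) = 1"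
  by (simp add: disk_reflection_eq_circle_reflection circle_reflection_on_circle side_ends)

lemma billiard_map_vertex: "a < m \<Longrightarrow> billiard_map m t (v a) = v a"
  by (simp add: billiard_map_eq vertex_mem_arc side_vertex)

lemma billiard_map_funpow_vertex: "a < m \<Longrightarrow> (billiard_map m t ^^ h) (v a) = v a"
  by (induction h) (simp_all add: billiard_map_vertex)

lemma billiard_map_eq_side: "norm \<sigma> = 1 \<Longrightarrow> \<exists>a<m. billiard_map m t \<sigma> = side a \<sigma>"
  using ex1_arc billiard_map_eq by blast

section \<open>Eventual coincidence of orbits\<close>

abbreviation merge :: "complex \<Rightarrow> complex \<Rightarrow> bool" where
  "merge \<sigma> \<sigma>' \<equiv> \<exists>h k. (billiard_map m t ^^ h) \<sigma> = (billiard_map m t ^^ k) \<sigma>'"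

text \<open>Both coincidences are iterated further until they share the point
  \<open>(?B ^^ (i + k)) \<sigma>'\<close>.\<close>

lemma merge_trans:
  assumes "merge \<sigma> \<sigma>'" "merge \<sigma>' \<sigma>''"
  shows "merge \<sigma> \<sigma>''"
proof -
  let ?B = "billiard_map m t"
  obtain h k i j where hk: "(?B ^^ h) \<sigma> = (?B ^^ k) \<sigma>'" and ij: "(?B ^^ i) \<sigma>' = (?B ^^ j) \<sigma>''"
    using assms by blast
  have "(?B ^^ (i + h)) \<sigma> = (?B ^^ (i + k)) \<sigma>'" by (simp add: funpow_add hk)
  also have "\<dots> = (?B ^^ (k + i)) \<sigma>'" by (simp add: add.commute)
  also have "\<dots> = (?B ^^ (k + j)) \<sigma>''" by (simp add: funpow_add ij)
  finally show ?thesis by blast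
qed

text \<open>\<open>B\<close> undoes the reflection whenever it does not perform it: off the arc \<open>I\<^sub>a\<close> and its end
  point, the reflection moves \<open>\<sigma>\<close> into \<open>I\<^sub>a\<close>.\<close>

lemma merge_side:
  assumes a: "a < m" and \<sigma>: "norm \<sigma> = 1"
  shows "merge \<sigma> (side a \<sigma>)"
proof -
  let ?B = "billiard_map m t"
  consider "\<sigma> \<in> ccw_arc (v a) (v (Suc a))" | "\<sigma> = v (Suc a)"
    | "\<sigma> \<notin> ccw_arc (v a) (v (Suc a))" "\<sigma> \<noteq> v (Suc a)"
    by blast
  then show ?thesis
  proof cases
    case 1
    then have "(?B ^^ 1) \<sigma> = (?B ^^ 0) (side a \<sigma>)" using billiard_map_eq a by simp
    then show ?thesis by blast
  next
    \<comment> \<open>The right end belongs to the next half-open arc, where \<open>B\<close> uses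
      another side, but the reflection fixes it.\<close>
    case 2
    then have "(?B ^^ 0) \<sigma> = (?B ^^ 0) (side a \<sigma>)" using side_vertex a by simp
    then show ?thesis by blast
  next
    case 3
    then have "side a \<sigma> \<in> ccw_arc (v a) (v (Suc a))"
      using circle_reflection_in_arc[OF norm_vertex norm_vertex \<sigma> vertex_neq_Suc[OF a]]
      by (simp add: disk_reflection_eq_circle_reflection \<sigma>)
    then have "(?B ^^ 0) \<sigma> = (?B ^^ 1) (side a \<sigma>)"
      using billiard_map_eq[OF a] disk_reflection_involution[OF norm_vertex norm_vertex vertex_neq_Suc[OF a]] \<sigma>
      by simp
    then show ?thesis by blast
  qed
qed

section \<open>Words in the side reflections\<close>

lemma norm_word:
  "set ws \<subseteq> {..<m} \<Longrightarrow> norm z = 1 \<Longrightarrow> norm (foldr side ws z) = 1"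
  by (induction ws) (simp_all add: norm_side)

lemma merge_word:
  assumes "set ws \<subseteq> {..<m}" "norm \<sigma> = 1"
  shows "merge \<sigma> (foldr side ws \<sigma>)"
  using assms(1)
proof (induction ws)
  case Nil
  show ?case by (intro exI[of _ 0]) simp
next
  case (Cons a ws)
  then have "merge (foldr side ws \<sigma>) (foldr side (a # ws) \<sigma>)"
    using merge_side[of a "foldr side ws \<sigma>"] norm_word[of ws \<sigma>] assms(2) by simp
  moreover have "merge \<sigma> (foldr side ws \<sigma>)" using Cons by simp
  ultimately show ?case by (rule merge_trans[rotated])
qed

text \<open>Each application of \<open>B\<close> is a side reflection chosen according to the
  current point, so the word depends on \<open>\<sigma>\<close>.\<close>

lemma billiard_map_funpow_eq_word:
  assumes "norm \<sigma> = 1"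
  shows "\<exists>ws. set ws \<subseteq> {..<m} \<and> (billiard_map m t ^^ h) \<sigma> = foldr side ws \<sigma>"
proof (induction h)
  case 0
  show ?case by (intro exI[of _ "[]"]) simp
next
  case (Suc h)
  then obtain ws where ws: "set ws \<subseteq> {..<m}" "(billiard_map m t ^^ h) \<sigma> = foldr side ws \<sigma>" by blast
  obtain a where "a < m" "billiard_map m t (foldr side ws \<sigma>) = side a (foldr side ws \<sigma>)"
    using billiard_map_eq_side norm_word[OF ws(1) assms] by blast
  with ws show ?case by (intro exI[of _ "a # ws"]) simp
qed

lemma word_cball:
  "set ws \<subseteq> {..<m} \<Longrightarrow> norm z \<le> 1 \<Longrightarrow> norm (foldr side ws z) \<le> 1"
proof (induction ws)
  case (Cons a ws)
  let ?z = "foldr side ws z"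
  have "norm ?z \<le> 1" "a < m" using Cons by auto
  then show ?case
    using norm_side[of a ?z] disk_reflection_in_disk[OF norm_vertex norm_vertex vertex_neq_Suc, of a ?z]
    by (cases "norm ?z = 1") auto
qed simp

lemma word_disk:
  "set ws \<subseteq> {..<m} \<Longrightarrow> z \<in> disk \<Longrightarrow> foldr side ws z \<in> disk"
  by (induction ws) (auto intro!: disk_reflection_in_disk[OF norm_vertex norm_vertex vertex_neq_Suc])

text \<open>Every side reflection is an involution. The closed disk covers both inverses in the
  group and the action on the circle.\<close>

lemma word_rev:
  "set ws \<subseteq> {..<m} \<Longrightarrow> norm z \<le> 1 \<Longrightarrow> foldr side (rev ws) (foldr side ws z) = z"
proof (induction ws)
  case (Cons a ws)
  then have "side a (side a (foldr side ws z)) = foldr side ws z"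
    using word_cball[of ws z]
    by (intro disk_reflection_involution[OF norm_vertex norm_vertex vertex_neq_Suc]) auto
  with Cons show ?case by simp
qed simp

lemma continuous_on_word:
  "set ws \<subseteq> {..<m} \<Longrightarrow> continuous_on (cball 0 1) (foldr side ws)"
proof (induction ws)
  case (Cons a ws)
  have "continuous_on (foldr side ws ` cball 0 1) (side a)"
    by (rule continuous_on_subset[OF continuous_on_disk_reflection[OF norm_vertex norm_vertex vertex_neq_Suc]])
      (use Cons word_cball in auto)
  with Cons have "continuous_on (cball 0 1) (side a \<circ> foldr side ws)"
    by (intro continuous_on_compose) auto
  then show ?case by (simp add: o_def)
qed (simp add: continuous_on_id)

text \<open>A word is continuous on the closed disk, so its limit from inside is its value at the
  boundary point; restricting it to the disk does not affect that limit.\<close>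

lemma boundary_action_word:
  assumes ws: "set ws \<subseteq> {..<m}" and \<sigma>: "norm \<sigma> = 1"
  shows "boundary_action (restrict (foldr side ws) disk) \<sigma> = foldr side ws \<sigma>"
  unfolding boundary_action_def
proof (rule tendsto_Lim)
  have "\<sigma> islimpt disk" using \<sigma> by (simp add: islimpt_ball)
  then show "at \<sigma> within disk \<noteq> bot" by (simp add: trivial_limit_within)
  have "(foldr side ws \<longlongrightarrow> foldr side ws \<sigma>) (at \<sigma> within cball 0 1)"
    using continuous_on_word[OF ws] \<sigma> by (simp add: continuous_on_def)
  then have "(foldr side ws \<longlongrightarrow> foldr side ws \<sigma>) (at \<sigma> within disk)"
    by (rule tendsto_within_subset) auto
  then show "(restrict (foldr side ws) disk \<longlongrightarrow> foldr side ws \<sigma>) (at \<sigma> within disk)"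
    by (rule Lim_transform_eventually) (auto simp: eventually_at_filter)
qed

section \<open>The reflection group as a set of words\<close>

lemma restrict_word_Bij:
  assumes "set ws \<subseteq> {..<m}"
  shows "restrict (foldr side ws) disk \<in> Bij disk"
proof -
  have "bij_betw (restrict (foldr side ws) disk) disk disk"
  proof (rule bij_betw_byWitness[where f' = "foldr side (rev ws)"])
    show "\<forall>z\<in>disk. foldr side (rev ws) (restrict (foldr side ws) disk z) = z"
      using word_rev[OF assms] by auto
    show "\<forall>z\<in>disk. restrict (foldr side ws) disk (foldr side (rev ws) z) = z"
      using word_rev[of "rev ws"] word_disk[of "rev ws"] assms by auto
    show "restrict (foldr side ws) disk ` disk \<subseteq> disk" "foldr side (rev ws) ` disk \<subseteq> disk"
      using word_disk[of ws] word_disk[of "rev ws"] assms by auto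
  qed
  then show ?thesis by (simp add: Bij_def)
qed

text \<open>With \<open>foldr\<close> the head of a word acts last, so concatenation matches
  composition.\<close>

lemma mult_words:
  assumes "set us \<subseteq> {..<m}" "set ws \<subseteq> {..<m}"
  shows "restrict (foldr side us) disk \<otimes>\<^bsub>BijGroup disk\<^esub> restrict (foldr side ws) disk
    = restrict (foldr side (us @ ws)) disk"
  using assms word_disk[OF assms(2)]
  by (auto simp: BijGroup_def restrict_word_Bij compose_def fun_eq_iff)

text \<open>The generators are their own inverses, so words without inverses exhaust the generated
  group.\<close>

lemma billiard_group_pm_eq_words:
  "billiard_group_pm m t = (\<lambda>ws. restrict (foldr side ws) disk) ` lists {..<m}"
proof (intro equalityI subsetI)
  fix g assume "g \<in> billiard_group_pm m t"
  then show "g \<in> (\<lambda>ws. restrict (foldr side ws) disk) ` lists {..<m}"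
    unfolding billiard_group_pm_def
  proof (induction rule: generate.induct)
    case one
    show ?case by (rule image_eqI[of _ _ "[]"]) (simp_all add: BijGroup_def restrict_def)
  next
    case (incl h)
    then obtain a where "a < m" "h = restrict (side a) disk" by blast
    then show ?case by (intro image_eqI[of _ _ "[a]"]) auto
  next
    case (inv h)
    then obtain a where a: "a < m" and h: "h = restrict (foldr side [a]) disk" by auto
    have hh: "h \<otimes>\<^bsub>BijGroup disk\<^esub> h = restrict (foldr side ([a] @ [a])) disk"
      unfolding h using a by (intro mult_words) auto
    also have "\<dots> = \<one>\<^bsub>BijGroup disk\<^esub>"
      using word_rev[of "[a]"] a by (auto simp: BijGroup_def fun_eq_iff)
    finally have "inv\<^bsub>BijGroup disk\<^esub> h = h"
      using restrict_word_Bij[of "[a]"] a h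
      by (intro group.inv_equality[OF group_BijGroup]) (auto simp: BijGroup_def)
    then show ?case using a h by (intro image_eqI[of _ _ "[a]"]) auto
  next
    case (eng g h)
    then obtain us ws where "us \<in> lists {..<m}" "ws \<in> lists {..<m}"
      "g = restrict (foldr side us) disk" "h = restrict (foldr side ws) disk"
      by blast
    then show ?case by (intro image_eqI[of _ _ "us @ ws"]) (auto simp: mult_words subset_iff)
  qed
next
  have "restrict (foldr side ws) disk \<in> billiard_group_pm m t" if "set ws \<subseteq> {..<m}" for ws
    using that
  proof (induction ws)
    case Nil
    have "restrict (foldr side []) disk = \<one>\<^bsub>BijGroup disk\<^esub>"
      by (simp add: BijGroup_def id_def)
    then show ?case unfolding billiard_group_pm_def by (simp only: generate.one)
  next
    case (Cons a ws)
    have "restrict (foldr side [a]) disk \<in> billiard_group_pm m t"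
      unfolding billiard_group_pm_def by (rule generate.incl) (use Cons in auto)
    moreover have "restrict (foldr side ws) disk \<in> billiard_group_pm m t"
      by (rule Cons.IH) (use Cons.prems in simp)
    ultimately have "restrict (foldr side [a]) disk \<otimes>\<^bsub>BijGroup disk\<^esub> restrict (foldr side ws) disk
        \<in> billiard_group_pm m t"
      unfolding billiard_group_pm_def by (rule generate.eng)
    also have "restrict (foldr side [a]) disk \<otimes>\<^bsub>BijGroup disk\<^esub> restrict (foldr side ws) disk
        = restrict (foldr side ([a] @ ws)) disk"
      using Cons.prems by (intro mult_words) auto
    finally show ?case by (simp only: append.simps)
  qed
  then show "\<And>g. g \<in> (\<lambda>ws. restrict (foldr side ws) disk) ` lists {..<m} \<Longrightarrow> g \<in> billiard_group_pm m t"
    by auto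
qed

lemma word_mem_billiard_group_pm:
  "set ws \<subseteq> {..<m} \<Longrightarrow> restrict (foldr side ws) disk \<in> billiard_group_pm m t"
  unfolding billiard_group_pm_eq_words lists_eq_set by (rule imageI) simp

text \<open>Words preserve eventual coincidence. Conversely, words lead from both points to a common
  iterate; going out along one and back along the reverse of the other gives the group
  element.\<close>

lemma orbit_equivalence:
  assumes \<sigma>: "norm \<sigma> = 1" and \<sigma>': "norm \<sigma>' = 1"
  shows "(\<exists>A\<in>billiard_group_pm m t. \<sigma>' = boundary_action A \<sigma>) \<longleftrightarrow> merge \<sigma> \<sigma>'"
proof
  assume "\<exists>A\<in>billiard_group_pm m t. \<sigma>' = boundary_action A \<sigma>"
  then obtain ws where "set ws \<subseteq> {..<m}" "\<sigma>' = foldr side ws \<sigma>"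
    using boundary_action_word[OF _ \<sigma>] unfolding billiard_group_pm_eq_words lists_eq_set by auto
  then show "merge \<sigma> \<sigma>'" using merge_word \<sigma> by simp
next
  assume "merge \<sigma> \<sigma>'"
  then obtain h k where hk: "(billiard_map m t ^^ h) \<sigma> = (billiard_map m t ^^ k) \<sigma>'" by blast
  obtain us ws where us: "set us \<subseteq> {..<m}" "(billiard_map m t ^^ h) \<sigma> = foldr side us \<sigma>"
    and ws: "set ws \<subseteq> {..<m}" "(billiard_map m t ^^ k) \<sigma>' = foldr side ws \<sigma>'"
    using billiard_map_funpow_eq_word \<sigma> \<sigma>' by meson
  have "\<sigma>' = foldr side (rev ws) (foldr side ws \<sigma>')" using word_rev[OF ws(1)] \<sigma>' by simp
  also have "\<dots> = foldr side (rev ws @ us) \<sigma>" using us ws hk by simp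
  also have "\<dots> = boundary_action (restrict (foldr side (rev ws @ us)) disk) \<sigma>"
    by (rule boundary_action_word[symmetric]) (use us ws \<sigma> in auto)
  finally show "\<exists>A\<in>billiard_group_pm m t. \<sigma>' = boundary_action A \<sigma>"
    by (rule bexI[of _ "restrict (foldr side (rev ws @ us)) disk"])
      (rule word_mem_billiard_group_pm, use us ws in auto)
qed

section \<open>Orientation and parity of words\<close>

text \<open>Each reflection contributes one conjugation, and two conjugations cancel.\<close>

lemma word_has_derivative:
  assumes "set ws \<subseteq> {..<m}" "z \<in> disk"
  shows "\<exists>c. c \<noteq> 0 \<and> (foldr side ws has_derivative (\<lambda>h. c * (if even (length ws) then h else cnj h))) (at z)"
  using assms(1)
proof (induction ws)
  case Nil
  have "(id has_derivative (\<lambda>h. 1 * h)) (at z)" by (simp add: has_derivative_id[unfolded id_def] id_def)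
  then show ?case by (intro exI[of _ 1]) simp
next
  case (Cons a ws)
  then obtain c where c: "c \<noteq> 0"
    "(foldr side ws has_derivative (\<lambda>h. c * (if even (length ws) then h else cnj h))) (at z)"
    by auto
  have "norm (foldr side ws z) < 1" using word_disk[of ws z] Cons assms by simp
  then obtain d where d: "d \<noteq> 0" "(side a has_derivative (\<lambda>h. d * cnj h)) (at (foldr side ws z))"
    using disk_reflection_has_derivative[OF norm_vertex norm_vertex vertex_neq_Suc] Cons.prems by force
  have "(foldr side (a # ws) has_derivative
      (\<lambda>h. d * cnj (c * (if even (length ws) then h else cnj h)))) (at z)"
    using has_derivative_compose[OF c(2) d(2)] by (simp add: o_def)
  also have "(\<lambda>h. d * cnj (c * (if even (length ws) then h else cnj h)))
    = (\<lambda>h. (d * cnj c) * (if even (length (a # ws)) then h else cnj h))"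
    by (auto simp: fun_eq_iff)
  finally show ?case using c d by (intro exI[of _ "d * cnj c"]) simp
qed

lemma even_word_mem_billiard_group:
  assumes ws: "set ws \<subseteq> {..<m}" and even: "even (length ws)"
  shows "restrict (foldr side ws) disk \<in> billiard_group m t"
  unfolding billiard_group_def orientation_preserving_def
proof (intro CollectI conjI ballI)
  show "restrict (foldr side ws) disk \<in> billiard_group_pm m t"
    by (rule word_mem_billiard_group_pm[OF ws])
  fix z :: complex assume z: "z \<in> disk"
  then obtain c where c: "c \<noteq> 0" "(foldr side ws has_derivative (\<lambda>h. c * h)) (at z)"
    using word_has_derivative[OF ws z] even by auto
  have "(restrict (foldr side ws) disk has_derivative (\<lambda>h. c * h)) (at z)"
    by (rule has_derivative_transform_within_open[OF c(2) open_ball z]) simp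
  \<comment> \<open>This is the determinant of multiplication by \<open>c\<close> as a real-linear
    map.\<close>
  moreover have "Re c * Re c + Im c * Im c > 0"
    using c(1) by (simp add: complex_eq_iff sum_squares_gt_zero_iff)
  ultimately show "\<exists>g'. (restrict (foldr side ws) disk has_derivative g') (at z) \<and>
      Re (g' 1) * Im (g' \<i>) - Im (g' 1) * Re (g' \<i>) > 0"
    by (intro exI[of _ "\<lambda>h. c * h"]) simp
qed

section \<open>Descent on integral null vectors\<close>

text \<open>Since \<open>t\<^sub>b\<close> is never inside the arc \<open>I\<^sub>a\<close> cut off by the side with normal vector \<open>w\<close>, reflection
  in this side brings any integral null vector above \<open>I\<^sub>a\<close> closer, in the Lorentz sense, to the
  interior point \<open>\<Sum>b<m. t b\<close> of the table. The Euclidean height \<open>r\<close> alone would not do: it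
  increases when \<open>I\<^sub>a\<close> is longer than \<open>\<pi>\<close>.\<close>

lemma terminating_integral:
  fixes x y r :: int
  assumes "r > 0" "x\<^sup>2 + y\<^sup>2 = r\<^sup>2" "\<sigma> = Complex (x / r) (y / r)"
  shows "terminating m t \<sigma>"
  using assms
proof (induction "nat (\<Sum>b<m. r * t b $ 3 - x * t b $ 1 - y * t b $ 2)" arbitrary: x y r \<sigma> rule: less_induct)
  case less
  have \<sigma>: "norm \<sigma> = 1"
    using norm_Complex_divide[of x y r] less.prems by (simp flip: of_int_power of_int_add)
  obtain a where a: "a < m" "\<sigma> \<in> ccw_arc (v a) (v (Suc a))" using ex1_arc[OF \<sigma>] by blast
  show ?case
  proof (cases "\<sigma> = v a")
    case True
    then show ?thesis unfolding terminating_def using a(1) by (intro exI[of _ 0] exI[of _ a]) simp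
  next
    case False
    define p q where "p = v a" and "q = v (Suc a)"
    define s where "s = arc_side p q"
    have pq: "norm p = 1" "norm q = 1" "p \<noteq> q"
      using a by (simp_all add: p_def q_def norm_vertex vertex_neq_Suc)
    interpret unimodular_arc_ends "t a" "t (next_index a)" p q
      by unfold_locales
        (use a pq triple next_index_less in \<open>auto simp: p_def q_def vertex_less vertex_Suc(2)\<close>)
    define w where "w = arc_vector (t a) (t (next_index a))"
    \<comment> \<open>Unimodularity enters here: the normal vector is integral, so reflecting along
      it keeps vectors integral.\<close>
    have "\<forall>i. w $ i \<in> \<int>"
      using partition a unfolding w_def unimodular_partition_def unimodular_arc_def by blast
    then obtain w1 w2 w3 :: int where w: "w $ 1 = w1" "w $ 2 = w2" "w $ 3 = w3"
      by (metis Ints_cases)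
    have s_pos: "s \<sigma> > 0"
      using arc_side_pos_iff[OF pq(1,2) \<sigma> pq(3)] a False by (simp add: s_def p_def q_def)
    \<comment> \<open>A vertex starts its own arc, and the arcs are disjoint, so it cannot lie
      inside another one.\<close>
    have s_vertex: "s (v b) \<le> 0" "s (v b) = 0 \<longleftrightarrow> b = a \<or> b = next_index a" if b: "b < m" for b
    proof -
      have "\<not> s (v b) > 0"
      proof
        assume "s (v b) > 0"
        then have "v b \<in> ccw_arc (v a) (v (Suc a))" "v b \<noteq> v a"
          using arc_side_pos_iff[OF pq(1,2) norm_vertex pq(3)] by (auto simp: s_def p_def q_def)
        then show False using ex1_arc[OF norm_vertex, of b] vertex_mem_arc[OF b] a b by auto
      qed
      then show "s (v b) \<le> 0" by simp
      show "s (v b) = 0 \<longleftrightarrow> b = a \<or> b = next_index a"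
        using arc_side_eq_0_iff[OF pq(1,2) norm_vertex pq(3), of b] vertex_inj[OF b] a next_index_less
        by (auto simp: s_def p_def q_def vertex_Suc(1))
    qed
    \<comment> \<open>The identity \<open>lorentz_arc_vector\<close>, scaled from points of the
      circle to integral null vectors.\<close>
    have lorentz_w: "x' * w1 + y' * w2 - r' * w3 = r' * s (Complex (x' / r') (y' / r'))"
      if "r' > 0" "x'\<^sup>2 + y'\<^sup>2 = r'\<^sup>2" for x' y' r' :: int
    proof -
      have "norm (Complex (x' / r') (y' / r')) = 1"
        by (rule norm_Complex_divide) (use that in \<open>auto simp flip: of_int_power of_int_add\<close>)
      from lorentz_arc_vector[OF this] show ?thesis
        using that by (simp add: w_def[symmetric] w s_def field_simps)
    qed
    define u where "u = x * w1 + y * w2 - r * w3"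
    have u: "real_of_int u = r * s \<sigma>"
      using lorentz_w[OF less.prems(1,2)] less.prems(3) by (simp add: u_def)
    then have u_pos: "u > 0" using s_pos less.prems(1) by (metis mult_pos_pos of_int_0_less_iff)
    \<comment> \<open>The Lorentz reflection of \<open>(x, y, r)\<close>, where \<open>u\<close> is
      the product of that vector with \<open>w\<close>. It will turn out to represent
      \<open>billiard_map m t \<sigma>\<close>.\<close>
    define x' y' r' where "x' = x - 2 * u * w1" and "y' = y - 2 * u * w2" and "r' = r - 2 * u * w3"
    have "real_of_int r' = r * stretch p q \<sigma>"
      unfolding stretch_arc_vector[OF \<sigma>] by (simp add: r'_def u w_def[symmetric] w s_def algebra_simps)
    moreover have "stretch p q \<sigma> > 0" using stretch_pos[OF pq(1,2) \<sigma> pq(3)] .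
    ultimately have r': "r' > 0" using less.prems(1) by (metis mult_pos_pos of_int_0_less_iff)
    define \<sigma>' where "\<sigma>' = billiard_map m t \<sigma>"
    have \<sigma>'_eq: "\<sigma>' = circle_reflection p q \<sigma>"
      using billiard_map_eq[OF a] \<sigma>
      by (simp add: \<sigma>'_def p_def q_def disk_reflection_eq_circle_reflection)
    then have norm_\<sigma>': "norm \<sigma>' = 1" using circle_reflection_on_circle[OF pq \<sigma>] by simp
    have "\<sigma>' * stretch p q \<sigma> = \<sigma> - 2 * s \<sigma> * Complex w1 w2"
      using circle_reflection_arc_vector[OF \<sigma>] unfolding \<sigma>'_eq s_def w_def[symmetric] w .
    then have "\<sigma>' * of_real r' = of_real r * (\<sigma> - 2 * s \<sigma> * Complex w1 w2)"
      unfolding \<open>real_of_int r' = r * stretch p q \<sigma>\<close> of_real_mult by (metis mult.left_commute)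
    moreover have "of_real r * (\<sigma> - 2 * s \<sigma> * Complex w1 w2) = Complex x' y'"
      using less.prems(1) by (simp add: complex_eq_iff x'_def y'_def u less.prems(3) algebra_simps)
    ultimately have "\<sigma>' = Complex x' y' / of_real r'"
      using r' by (simp add: field_simps)
    then have \<sigma>': "\<sigma>' = Complex (x' / r') (y' / r')"
      by (simp only: complex_eq_iff Re_divide_of_real Im_divide_of_real complex.sel)
    have "(x' / r')\<^sup>2 + (y' / r')\<^sup>2 = 1"
      using norm_\<sigma>' unfolding \<sigma>' by (simp add: complex_norm)
    then have "real_of_int (x'\<^sup>2 + y'\<^sup>2) = real_of_int (r'\<^sup>2)"
      using r' by (simp add: field_simps)
    then have null': "x'\<^sup>2 + y'\<^sup>2 = r'\<^sup>2" unfolding of_int_eq_iff .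
    define H where "H = (\<lambda>x y r. \<Sum>b<m. r * t b $ 3 - x * t b $ 1 - y * t b $ 2)"
    have t3: "t b $ 3 > 0" "(t b $ 1)\<^sup>2 + (t b $ 2)\<^sup>2 = (t b $ 3)\<^sup>2" if "b < m" for b
      using triple[OF that] by (simp_all add: pythagorean_triple_def)
    have H_nonneg: "H x' y' r' \<ge> 0"
      unfolding H_def
    proof (rule sum_nonneg)
      fix b assume "b \<in> {..<m}"
      then have "b < m" by simp
      from lorentz_nonpos[OF null' r' t3(2)[OF this] t3(1)[OF this]]
      show "r' * t b $ 3 - x' * t b $ 1 - y' * t b $ 2 \<ge> 0" by linarith
    qed
    define e where "e = (\<lambda>b. t b $ 1 * w1 + t b $ 2 * w2 - t b $ 3 * w3)"
    have e: "real_of_int (e b) = t b $ 3 * s (v b)" if "b < m" for b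
      using lorentz_w[OF t3[OF that]] that by (simp add: e_def vertex_less circle_point_eq_Complex)
    have e_nonpos: "e b \<le> 0" if "b < m" for b
    proof -
      have "t b $ 3 * s (v b) \<le> 0"
        using s_vertex(1) t3(1) that by (intro mult_nonneg_nonpos) (auto simp: less_imp_le)
      then have "real_of_int (e b) \<le> 0" using e[OF that] by linarith
      then show ?thesis by simp
    qed
    \<comment> \<open>The two ends of the side contribute 0 to the sum of the \<open>e b\<close>.
      Strict decrease needs a third vertex; as \<open>m \<ge> 3\<close>, two places after
      \<open>a\<close> is one.\<close>
    define b where "b = Suc (Suc a) mod m"
    have b: "b < m" "b \<noteq> a" "b \<noteq> next_index a"
      using m a(1) unfolding b_def by (auto simp: mod_Suc)
    have "e b \<noteq> 0" using e[OF b(1)] s_vertex(2)[OF b(1)] t3(1)[OF b(1)] b by auto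
    with e_nonpos b(1) have "(\<Sum>b<m. e b) < (\<Sum>b<m. 0)"
      by (intro sum_strict_mono_ex1) (auto intro!: bexI[of _ b] simp: less_le)
    then have "2 * u * (\<Sum>b<m. e b) < 0" using u_pos by (simp add: mult_pos_neg)
    \<comment> \<open>\<open>H\<close> is linear, and \<open>e b\<close> is the Lorentz product of
      \<open>t b\<close> with \<open>w\<close>.\<close>
    moreover have "H x' y' r' = H x y r + 2 * u * (\<Sum>b<m. e b)"
      unfolding H_def e_def x'_def y'_def r'_def sum_distrib_left sum.distrib[symmetric]
      by (intro sum.cong) (auto simp: algebra_simps)
    \<comment> \<open>Nonnegativity of the smaller value makes the decrease survive truncation by
      \<open>nat\<close>.\<close>
    ultimately have "nat (H x' y' r') < nat (H x y r)" using H_nonneg by linarith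
    then have "terminating m t \<sigma>'" using less.hyps[OF _ r' null' \<sigma>'] unfolding H_def by blast
    then obtain h c where "c < m" "(billiard_map m t ^^ h) \<sigma>' = v c"
      unfolding terminating_def by blast
    then show ?thesis
      unfolding terminating_def \<sigma>'_def
      by (intro exI[of _ "Suc h"] exI[of _ c]) (simp add: funpow_swap1)
  qed
qed

section \<open>The landing vertex of a Gaussian rational point\<close>

lemma gaussian_rational_lands:
  assumes \<sigma>: "norm \<sigma> = 1" "\<sigma> \<in> gaussian_rationals"
  shows "terminating m t \<sigma> \<and>
    (\<exists>u\<in>v ` {..<m}. (\<exists>h. (billiard_map m t ^^ h) \<sigma> = u) \<and>
       (\<exists>A\<in>billiard_group m t. boundary_action A \<sigma> = u) \<and>
       (\<forall>u'\<in>v ` {..<m}. (\<exists>A\<in>billiard_group m t. boundary_action A \<sigma> = u') \<longrightarrow> u' = u))"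
proof (intro conjI)
  show terminates: "terminating m t \<sigma>"
    using gaussian_rational_on_circle[OF \<sigma>] terminating_integral by metis
  then obtain h a where a: "a < m" and h: "(billiard_map m t ^^ h) \<sigma> = v a"
    unfolding terminating_def by blast
  have landing: "\<exists>h. (billiard_map m t ^^ h) \<sigma> = v a" using h by blast
  obtain ws where ws: "set ws \<subseteq> {..<m}" "v a = foldr side ws \<sigma>"
    using billiard_map_funpow_eq_word[OF \<sigma>(1), of h] h by auto
  \<comment> \<open>the reflection in a side at \<open>v a\<close> fixes \<open>v a\<close>, so it can correct the parity\<close>
  define us where "us = (if even (length ws) then ws else a # ws)"
  have us: "set us \<subseteq> {..<m}" "even (length us)" "foldr side us \<sigma> = v a"
    using ws a side_vertex(1)[OF a] by (auto simp: us_def)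
  then have "boundary_action (restrict (foldr side us) disk) \<sigma> = v a"
    using boundary_action_word \<sigma>(1) by metis
  then have equivalent: "\<exists>A\<in>billiard_group m t. boundary_action A \<sigma> = v a"
    using even_word_mem_billiard_group us by metis
  have "u' = v a" if u': "u' \<in> v ` {..<m}" and A: "A \<in> billiard_group m t" "boundary_action A \<sigma> = u'" for u' A
  proof -
    obtain b where b: "b < m" "u' = v b" using u' by blast
    have "A \<in> billiard_group_pm m t" using A by (simp add: billiard_group_def)
    moreover have "v b = boundary_action A \<sigma>" using A b by simp
    ultimately have "merge \<sigma> (v b)"
      using orbit_equivalence[OF \<sigma>(1) norm_vertex, of b] by blast
    moreover have "merge (v a) \<sigma>" using h by (metis funpow_0)
    ultimately have "merge (v a) (v b)" by (rule merge_trans[rotated])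
    then show ?thesis using a b by (simp add: billiard_map_funpow_vertex)
  qed
  with landing equivalent a
  show "\<exists>u\<in>v ` {..<m}. (\<exists>h. (billiard_map m t ^^ h) \<sigma> = u) \<and>
       (\<exists>A\<in>billiard_group m t. boundary_action A \<sigma> = u) \<and>
       (\<forall>u'\<in>v ` {..<m}. (\<exists>A\<in>billiard_group m t. boundary_action A \<sigma> = u') \<longrightarrow> u' = u)"
    by blast
qed

end

theorem theorem8p1:
  fixes m :: nat and t :: "nat \<Rightarrow> int ^ 3"
  assumes "unimodular_partition m t"
  shows "(\<forall>\<sigma>\<in>sphere 0 1. \<forall>\<sigma>'\<in>sphere 0 1.
            (\<exists>A\<in>billiard_group_pm m t. \<sigma>' = boundary_action A \<sigma>) \<longleftrightarrow>
            (\<exists>h k. (billiard_map m t ^^ h) \<sigma> = (billiard_map m t ^^ k) \<sigma>')) \<and>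
         (\<forall>\<sigma>\<in>sphere 0 1. \<sigma> \<in> gaussian_rationals \<longrightarrow>
            terminating m t \<sigma> \<and>
            (\<exists>v\<in>vertex m t ` {..<m}.
               (\<exists>h. (billiard_map m t ^^ h) \<sigma> = v) \<and>
               (\<exists>A\<in>billiard_group m t. boundary_action A \<sigma> = v) \<and>
               (\<forall>u\<in>vertex m t ` {..<m}. (\<exists>A\<in>billiard_group m t. boundary_action A \<sigma> = u) \<longrightarrow> u = v)))"
proof -
  interpret billiard_table m t by unfold_locales (rule assms)
  show ?thesis using orbit_equivalence gaussian_rational_lands by simp
qed

end
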